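(* Let $S\subseteq \mathbb{N}\times\mathbb{N}$ with $(0,0)\notin S$. Suppose $S$ contains $(1,0)$ and no other horizontal step, and satisfies the slope condition for the boundary $(i+1)_{i\ge 0}=(1,2,3,\ldots)$. Then, as formal power series, $$P(t)=\frac{D_0(t)}{1+D_1(t)}.$$
   Context: $\mathbb{N}$ is the set of non-negative integers. A horizontal step is a step $(a,0)$ with $a>0$. An $S$-path from $(n_0,m_0)$ to $(n,m)$ is a finite (possibly empty) sequence of steps $(a_1,b_1),\ldots,(a_k,b_k)$ in $S$ with $(n_0+a_1+\cdots+a_k,\,m_0+b_1+\cdots+b_k)=(n,m)$. Its nodes are the starting point and the points reached after each step. Let $\underline{s}=(s_i)_{i\ge 0}$ be a non-decreasing sequence of positive integers. An $S$-path starting at $(0,0)$ has (right) boundary $\underline{s}$ if every node of the form $(x,i)$ satisfies $x<s_i$ (equivalently, for the step sets considered here, the path viewed as a piecewise linear path lies strictly to the left of the union of the segments joining $(s_i,i)$ to $(s_{i+1},i+1)$, $i\ge 0$). $S$ satisfies the slope condition for the boundary $\underline{s}$ if for every $(a,b)\in S$ with $b\ne 0$ and every index $i\ge 0$, $s_{i+j}>s_i-1+ja/b$ for all $j=1,\ldots,b$. $a_{n,m}$ is the number of $S$-paths from $(0,0)$ to $(n,m)$. $p_n$ is the number of $S$-paths from $(0,0)$ to $(n,n)$ with right boundary $(i+1)_{i\ge 0}$ (Catalan $S$-paths). Generating functions: $P(t)=\sum_{n\ge 0}p_nt^n$ and $D_h(t)=\sum_{n\ge h}a_{n-h,n}t^n$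 for integers $h\ge 0$. *)

theory Defs
  imports
    "HOL-Library.Product_Plus"
    "HOL-Computational_Algebra.Formal_Power_Series"
begin

type_synonym point = "nat \<times> nat"

definition horizontal_step :: "point \<Rightarrow> bool" where
  "horizontal_step v \<longleftrightarrow> fst v > 0 \<and> snd v = 0"

definition path_from_to :: "point set \<Rightarrow> point \<Rightarrow> point \<Rightarrow> point list \<Rightarrow> bool" where
  "path_from_to S P Q vs \<longleftrightarrow> set vs \<subseteq> S \<and> P + sum_list vs = Q"

fun nodes :: "point \<Rightarrow> point list \<Rightarrow> point set" where
  "nodes P [] = {P}"
| "nodes P (v # vs) = insert P (nodes (P + v) vs)"

definition has_boundary :: "(nat \<Rightarrow> nat) \<Rightarrow> point list \<Rightarrow> bool" where
  "has_boundary s vs \<longleftrightarrow> (\<forall>(x, i) \<in> nodes (0, 0) vs. x < s i)"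

definition slope_condition :: "point set \<Rightarrow> (nat \<Rightarrow> nat) \<Rightarrow> bool" where
  "slope_condition S s \<longleftrightarrow>
     (\<forall>(a, b) \<in> S. b \<noteq> 0 \<longrightarrow>
        (\<forall>i. \<forall>j\<in>{1..b}.
           (of_nat (s (i + j)) :: rat) > of_nat (s i) - 1 + of_nat j * of_nat a / of_nat b))"

(* The two cardinalities below are those of finite sets as soon as (0,0) is not a step,
   see finite_paths. *)

definition num_paths :: "point set \<Rightarrow> nat \<Rightarrow> nat \<Rightarrow> nat" where
  "num_paths S n m = card {vs. path_from_to S (0, 0) (n, m) vs}"

definition num_catalan_paths :: "point set \<Rightarrow> nat \<Rightarrow> nat" where
  "num_catalan_paths S n =
     card {vs. path_from_to S (0, 0) (n, n) vs \<and> has_boundary (\<lambda>i. i + 1) vs}"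

(* Rational coefficients make the series ring one with division; a series with constant
   coefficient 1 is a unit there. *)

definition P_fps :: "point set \<Rightarrow> rat fps" where
  "P_fps S = Abs_fps (\<lambda>n. of_nat (num_catalan_paths S n))"

definition D_fps :: "point set \<Rightarrow> nat \<Rightarrow> rat fps" where
  "D_fps S h = Abs_fps (\<lambda>n. if h \<le> n then of_nat (num_paths S (n - h) n) else 0)"

lemma finite_paths:
  assumes "(0, 0) \<notin> S"
  shows "finite {vs. path_from_to S (0, 0) (n, m) vs}"
proof -
  have *: "length vs \<le> fst (sum_list vs) + snd (sum_list vs) \<and>
           set vs \<subseteq> {..fst (sum_list vs)} \<times> {..snd (sum_list vs)}" if "set vs \<subseteq> S" for vs
    using that
  proof (induction vs)
    case Nil
    then show ?case by simp
  next
    case (Cons v vs)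
    have "v \<noteq> (0, 0)" using Cons.prems assms by auto
    then have "fst v + snd v \<ge> 1" by (cases v) auto
    with Cons show ?case by fastforce
  qed
  have "{vs. path_from_to S (0, 0) (n, m) vs} \<subseteq>
        {vs. set vs \<subseteq> {..n} \<times> {..m} \<and> length vs \<le> n + m}"
  proof
    fix vs assume "vs \<in> {vs. path_from_to S (0, 0) (n, m) vs}"
    then have "set vs \<subseteq> S" "sum_list vs = (n, m)"
      by (auto simp: path_from_to_def zero_prod_def[symmetric])
    with *[of vs] show "vs \<in> {vs. set vs \<subseteq> {..n} \<times> {..m} \<and> length vs \<le> n + m}" by simp
  qed
  moreover have "finite {vs. set vs \<subseteq> {..n} \<times> {..m} \<and> length vs \<le> n + m}"
    by (rule finite_lists_length_le) simp
  ultimately show ?thesis by (rule finite_subset)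
qed

end

(* Under the slope condition every step other than (1,0) has a \<le> b, so x - y grows by at most 1
   per step. A path from (0,0) to (n,n) that violates the boundary therefore leaves the region
   x \<le> y for the first time by a step (1,0) starting at some (k,k). Cutting there leaves a Catalan
   path to (k,k) and an arbitrary path of displacement (n-k-1, n-k), whence
   a_{n,n} = p_n + (\<Sum>k<n. p_k a_{n-k-1,n-k}), i.e. D_0 = P (1 + D_1). *)

theory Submission
  imports Defs
begin

text \<open>The slope condition at \<open>i = 0\<close>, \<open>j = b\<close> reads
  \<open>b + 1 > a\<close>, and \<open>a\<close>, \<open>b\<close> are integers.\<close>

lemma slope_condition_succ_le:
  assumes "slope_condition S (\<lambda>i. i + 1)" "(a, b) \<in> S" "b \<noteq> 0"
  shows "a \<le> b"
proof -
  have "\<forall>j\<in>{1..b}. (of_nat (0 + j + 1) :: rat)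
      > of_nat (0 + 1) - 1 + of_nat j * of_nat a / of_nat b"
    using assms unfolding slope_condition_def by blast
  then have "(of_nat (0 + b + 1) :: rat) > of_nat (0 + 1) - 1 + of_nat b * of_nat a / of_nat b"
    by (rule bspec) (use assms(3) in auto)
  with assms(3) have "(of_nat (b + 1) :: rat) > of_nat a"
    by simp
  then show ?thesis
    by (simp only: of_nat_less_iff)
qed

lemma start_in_nodes: "P \<in> nodes P vs"
  by (cases vs) auto

lemma nodes_append: "nodes P (us @ ws) = nodes P us \<union> nodes (P + sum_list us) ws"
  by (induction us arbitrary: P) (auto simp: add.assoc start_in_nodes)

lemma end_in_nodes: "P + sum_list us \<in> nodes P us"
  using nodes_append[of P us "[]"] by auto

lemma has_boundary_appendD: "has_boundary s (us @ ws) \<Longrightarrow> has_boundary s us"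
  by (auto simp: has_boundary_def nodes_append)

text \<open>Appending a step creates exactly one new node, the new endpoint; this drives the
  induction from the right below.\<close>

lemma has_boundary_snoc:
  "has_boundary s (us @ [v]) \<longleftrightarrow>
     has_boundary s us \<and> fst (sum_list us + v) < s (snd (sum_list us + v))"
proof -
  have "nodes (0, 0) (us @ [v]) = insert (sum_list us + v) (nodes (0, 0) us)"
    using end_in_nodes[of 0 us] by (auto simp: nodes_append zero_prod_def[symmetric])
  then show ?thesis
    unfolding has_boundary_def by (cases "sum_list us + v") auto
qed

text \<open>Induction on the last step. If the path already violates the boundary before it, that
  step is absorbed into \<open>ws\<close>; otherwise it makes the first crossing, and the step
  bounds leave only (1,0) from the diagonal.\<close>

lemma not_has_boundary_decompose:
  assumes "\<And>a b. (a, b) \<in> S \<Longrightarrow> (a, b) = (1, 0) \<or> a \<le> b"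
    and "set vs \<subseteq> S" "\<not> has_boundary (\<lambda>i. i + 1) vs"
  shows "\<exists>us ws k. vs = us @ (1, 0) # ws \<and> has_boundary (\<lambda>i. i + 1) us \<and> sum_list us = (k, k)"
  using assms(2,3)
proof (induction vs rule: rev_induct)
  case Nil
  then show ?case by (simp add: has_boundary_def)
next
  case (snoc v vs)
  show ?case
  proof (cases "has_boundary (\<lambda>i. i + 1) vs")
    case False
    with snoc obtain us ws k where
      "vs = us @ (1, 0) # ws" "has_boundary (\<lambda>i. i + 1) us" "sum_list us = (k, k)"
      by auto
    then have "vs @ [v] = us @ (1, 0) # (ws @ [v])" by simp
    then show ?thesis using \<open>has_boundary _ us\<close> \<open>sum_list us = _\<close> by blast
  next
    case True
    obtain x y where xy: "sum_list vs = (x, y)" by fastforce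
    obtain a b where v: "v = (a, b)" by fastforce
    \<comment> \<open>The boundary allows exactly the nodes with x \<le> y. Together, x \<le> y and
      x + a > y + b give a > b, so the step is (1,0), and then x + 1 > y forces x = y.\<close>
    have "x + a > y + b"
      using snoc.prems(2) True by (simp add: has_boundary_snoc xy v)
    moreover have "x \<le> y"
    proof -
      have "sum_list vs \<in> nodes (0, 0) vs"
        using end_in_nodes[of "(0, 0)" vs] by (simp add: zero_prod_def[symmetric])
      with True xy show ?thesis by (auto simp: has_boundary_def)
    qed
    moreover have "(a, b) = (1, 0) \<or> a \<le> b"
      using snoc.prems(1) v assms(1) by simp
    ultimately have "v = (1, 0)" "x = y" using v by auto
    with True xy show ?thesis by blast
  qed
qed

text \<open>The step (1,0) leads to the node (k + 1, k), where the boundary demands a first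
  coordinate below k + 1.\<close>

lemma diagonal_crossing_violates_boundary:
  assumes "sum_list us = (k, k)"
  shows "\<not> has_boundary (\<lambda>i. i + 1) (us @ (1, 0) # ws)"
proof
  assume "has_boundary (\<lambda>i. i + 1) (us @ (1, 0) # ws)"
  then have "has_boundary (\<lambda>i. i + 1) (us @ [(1, 0)])"
    using has_boundary_appendD[of _ "us @ [(1, 0)]" ws] by simp
  then show False
    by (simp add: has_boundary_snoc assms)
qed

text \<open>If the cuts differed, the longer prefix would contain the shorter one followed by its
  crossing step (1,0), and so violate the boundary.\<close>

lemma first_crossing_unique:
  assumes "us @ (1, 0) # ws = us' @ (1, 0) # ws'"
    and "has_boundary (\<lambda>i. i + 1) us" "sum_list us = (k, k)"
    and "has_boundary (\<lambda>i. i + 1) us'" "sum_list us' = (k', k')"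
  shows "us = us' \<and> ws = ws'"
proof -
  obtain zs where zs:
    "us = us' @ zs \<and> zs @ (1, 0) # ws = (1, 0) # ws' \<or>
     us @ zs = us' \<and> (1, 0) # ws = zs @ (1, 0) # ws'"
    using assms(1) by (auto simp: append_eq_append_conv2)
  show ?thesis
  proof (cases zs)
    case Nil
    with zs show ?thesis by auto
  next
    case (Cons z zs')
    with zs have "us = us' @ (1, 0) # zs' \<or> us' = us @ (1, 0) # zs'" by auto
    then show ?thesis
      using diagonal_crossing_violates_boundary assms(2-5) by blast
  qed
qed

lemma num_paths_diagonal:
  assumes "(0, 0) \<notin> S" "(1, 0) \<in> S"
    and steps: "\<And>a b. (a, b) \<in> S \<Longrightarrow> (a, b) = (1, 0) \<or> a \<le> b"
  shows "num_paths S n n =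
    num_catalan_paths S n + (\<Sum>k<n. num_catalan_paths S k * num_paths S (n - k - 1) (n - k))"
proof -
  define A where "A = (\<lambda>n m. {vs. path_from_to S (0, 0) (n, m) vs})"
  define C where
    "C = (\<lambda>n. {vs. path_from_to S (0, 0) (n, n) vs \<and> has_boundary (\<lambda>i. i + 1) vs})"
  \<comment> \<open>\<open>glue\<close> inverts the cut at the first crossing; \<open>B k\<close>
    collects the pairs whose crossing starts at (k,k).\<close>
  define glue :: "point list \<times> point list \<Rightarrow> point list"
    where "glue = (\<lambda>(us, ws). us @ (1, 0) # ws)"
  define B where "B = (\<lambda>k. C k \<times> A (n - k - 1) (n - k))"
  have A_iff: "vs \<in> A x y \<longleftrightarrow> set vs \<subseteq> S \<and> sum_list vs = (x, y)" for vs x y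
    by (simp add: A_def path_from_to_def zero_prod_def[symmetric])
  have C_iff: "vs \<in> C k \<longleftrightarrow> vs \<in> A k k \<and> has_boundary (\<lambda>i. i + 1) vs" for vs k
    by (simp add: A_def C_def)
  have finA: "finite (A x y)" for x y
    unfolding A_def by (rule finite_paths[OF assms(1)])
  have finC: "finite (C k)" for k
    by (rule finite_subset[OF _ finA[of k k]]) (auto simp: C_iff)
  have finB: "finite (B k)" for k
    unfolding B_def using finA finC by blast
  have "A n n \<subseteq> C n \<union> glue ` (\<Union>k<n. B k)"
  proof
    fix vs assume vs: "vs \<in> A n n"
    show "vs \<in> C n \<union> glue ` (\<Union>k<n. B k)"
    proof (cases "has_boundary (\<lambda>i. i + 1) vs")
      case True
      with vs show ?thesis by (simp add: C_iff)
    next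
      case False
      then obtain us ws k where *:
        "vs = us @ (1, 0) # ws" "has_boundary (\<lambda>i. i + 1) us" "sum_list us = (k, k)"
        using not_has_boundary_decompose[of S vs] steps vs unfolding A_iff by blast
      obtain x y where xy: "sum_list ws = (x, y)" by fastforce
      \<comment> \<open>The first equation gives k < n, so the truncated subtractions in
        \<open>B k\<close> are exact.\<close>
      have "k + 1 + x = n" "k + y = n"
        using vs by (auto simp: A_iff * xy)
      then have "k < n" "(us, ws) \<in> B k"
        using vs * xy by (auto simp: B_def A_iff C_iff)
      then show ?thesis
        using *(1) by (force simp: glue_def)
    qed
  qed
  moreover have "glue ` (\<Union>k<n. B k) \<subseteq> A n n"
    using assms(2) by (auto simp: glue_def B_def A_iff C_iff)
  ultimately have "A n n = C n \<union> glue ` (\<Union>k<n. B k)"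
    by (auto simp: C_iff)
  moreover have "C n \<inter> glue ` (\<Union>k<n. B k) = {}"
    using diagonal_crossing_violates_boundary by (auto simp: glue_def B_def A_iff C_iff)
  moreover have "inj_on glue (\<Union>k<n. B k)"
  proof (rule inj_onI)
    fix p q assume pq: "p \<in> (\<Union>k<n. B k)" "q \<in> (\<Union>k<n. B k)" "glue p = glue q"
    obtain us ws us' ws' where "p = (us, ws)" "q = (us', ws')" by fastforce
    with pq show "p = q"
      using first_crossing_unique[of us ws us' ws'] by (auto simp: glue_def B_def A_iff C_iff)
  qed
  \<comment> \<open>The sets \<open>B k\<close> are disjoint since the endpoint (k,k) of the first
    component determines k.\<close>
  moreover have "card (\<Union>k<n. B k) = (\<Sum>k<n. card (B k))"
    using finB by (intro card_UN_disjoint) (auto simp: B_def A_iff C_iff)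
  ultimately have "card (A n n) = card (C n) + (\<Sum>k<n. card (B k))"
    using finB finC by (simp add: card_Un_disjoint card_image)
  then show ?thesis
    by (simp add: num_paths_def num_catalan_paths_def A_def B_def C_def card_cartesian_product)
qed

theorem theorem2p4:
  fixes S :: "(nat \<times> nat) set"
  assumes "(0, 0) \<notin> S"
    and "(1, 0) \<in> S"
    and "\<And>v. v \<in> S \<Longrightarrow> horizontal_step v \<Longrightarrow> v = (1, 0)"
    and "slope_condition S (\<lambda>i. i + 1)"
  shows "P_fps S = D_fps S 0 / (1 + D_fps S 1)"
proof -
  \<comment> \<open>For b = 0, either a = 0 and a \<le> b, or the step is horizontal and hence
    (1,0).\<close>
  have steps: "(a, b) = (1, 0) \<or> a \<le> b" if "(a, b) \<in> S" for a b
    using that assms(3)[OF that] slope_condition_succ_le[OF assms(4) that]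
    by (cases "b = 0") (auto simp: horizontal_step_def)
  have "P_fps S * (1 + D_fps S 1) = D_fps S 0"
  proof (rule fps_ext)
    fix n
    have "fps_nth (P_fps S * (1 + D_fps S 1)) n =
        (\<Sum>k\<le>n. fps_nth (P_fps S) k * fps_nth (1 + D_fps S 1) (n - k))"
      by (simp only: fps_mult_nth atLeast0AtMost)
    \<comment> \<open>The term k = n splits off with factor 1, because \<open>D_fps S 1\<close> has
      constant coefficient 0.\<close>
    also have "\<dots> = fps_nth (P_fps S) n +
        (\<Sum>k<n. fps_nth (P_fps S) k * fps_nth (1 + D_fps S 1) (n - k))"
      by (simp add: lessThan_Suc_atMost[symmetric] D_fps_def)
    \<comment> \<open>For k < n the index n - k is at least 1, so the summand 1 of
      \<open>1 + D_fps S 1\<close> contributes nothing.\<close>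
    also have "\<dots> = of_nat (num_catalan_paths S n +
        (\<Sum>k<n. num_catalan_paths S k * num_paths S (n - k - 1) (n - k)))"
      by (auto simp: P_fps_def D_fps_def intro!: sum.cong)
    also have "\<dots> = fps_nth (D_fps S 0) n"
      by (simp only: num_paths_diagonal[OF assms(1,2) steps, symmetric]) (simp add: D_fps_def)
    finally show "fps_nth (P_fps S * (1 + D_fps S 1)) n = fps_nth (D_fps S 0) n" .
  qed
  \<comment> \<open>Cancelling the factor needs it nonzero; its constant coefficient is 1.\<close>
  moreover have "1 + D_fps S 1 \<noteq> 0"
  proof
    assume "1 + D_fps S 1 = 0"
    then have "fps_nth (1 + D_fps S 1) 0 = 0" by simp
    then show False by (simp add: D_fps_def)
  qed
  ultimately show ?thesis
    by (metis nonzero_mult_div_cancel_right)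
qed

end
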